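(* There is an $\varepsilon_0>0$ (depending on the problem data, the method parameters and the linear system solver) such that for every unit roundoff $0<\varepsilon_{mach}\le\varepsilon_0$ the following holds. Let $\tilde z\in\mathcal{N}(\tau,\nu_0)$, where $\tau\in[\tau_E,\tau_A]$. Define $\hat\tau:=\sigma\tau$, solve the linear system $$DF(\tilde z)\,\Delta\tilde z=-F_{\hat\tau}(\tilde z)$$ on an IEEE machine with unit roundoff $\varepsilon_{mach}$ with a numerically stable algorithm, and compute $\hat{\tilde z}:=\tilde z+\Delta\tilde z$. Then $\hat{\tilde z}\in\mathcal{N}(\hat\tau,\nu_1)$.
   Context: $n,m\ge1$; $Q\in\mathbb{R}^{n\times n}$ symmetric positive semidefinite, $c\in\mathbb{R}^n$, $A\in\mathbb{R}^{m\times n}$, $b\in\mathbb{R}^m$, $\mathrm{tol}>0$. $\mathbf 1$ is the all-ones vector; products of vectors of equal length are componentwise. $\|\cdot\|_2$ is the Euclidean/spectral norm, $\|\cdot\|_F$ the Frobenius norm. Method parameters: positive reals satisfying (an upper bound with zero denominator is vacuous) $\theta\le0.3$; $\beta\le\theta$; $1-\beta/\sqrt{2n}\le\sigma<1$; $N=3n+m$; $C_q\ge\|Q\|_2n+\|c\|_2\sqrt n$; $\omega\le\min\{\frac{\mathrm{tol}}{2n},\frac{\mathrm{tol}^2}{16(4C_q+n)},1\}$; $C_\lambda\ge(\|A\|_2\sqrt n+\|b\|_2)/\omega$; $C_{\Delta\mu}\ge(\omega+\|Q\|_2)\sqrt n+\|c\|_2+\|A\|_2C_\lambda$; $\tau_A\ge\max\{\frac14\|Q+\omega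 I+\frac1\omega A^{\mathsf T}A\|_2,4\|c-\frac1\omega A^{\mathsf T}b\|_2\}$; $\tau_E\le\frac{\mathrm{tol}^2\omega}{48n\max\{\|A\|_2,C_q\}}$; $C_\mu\ge\sqrt{2n}(C_{\Delta\mu}+(1+\theta)\tau_A)$; $C_z\ge\sqrt{n+C_\lambda^2+C_\mu^2}+0.1$; $c_{gap}\le\frac{1-\theta}{1+C_z}\cdot\frac{\sigma\tau_E}2$; $C_{DF}\ge\|Q\|_2+2\omega+2\|A\|_F+4+4C_z$; $C_{DFinv}\ge\frac1{c_{gap}}\max\{\frac1\omega,\frac{C_z}{c_{gap}}\}$; $\kappa_{DF}\ge C_{DF}C_{DFinv}$; $C_{\delta F}\ge C_{DF}$; $C_{\delta DF}\ge2$; $C_{\delta\Delta z}\ge2\kappa_{DF}$; $C_\nu\ge\max\{2C_{\delta\Delta z}(C_{\delta F}C_{DFinv}+\frac2\omega C_{\delta DF}C_z),1+C_{DFinv}C_{\delta F}\}$; $\nu_2\le\min\{0.1,\frac{c_{gap}}{C_\nu},\frac\omega{2C_{\delta DF}\kappa_{DF}},\frac{\theta\sigma\tau_E}{2C_\nu C_{\delta F}}\}$; $\nu_1\le\nu_2/C_\nu$; $\nu_0\le\min\{\nu_1/C_\nu,\frac{\mathrm{tol}}{2\max\{\|A\|_2,C_q\}}\}$. For $z=(x,\lambda,\mu_L,\mu_R)\in\mathbb{R}^n\times\mathbb{R}^m\times\mathbb{R}^n\times\mathbb{R}^n=\mathbb{R}^N$ and $\tau>0$: $$F_\tau(z)=\begin{pmatrix}Qx+\omega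 x+c-A^{\mathsf T}\lambda-\mu_L+\mu_R\\ Ax-b+\omega\lambda\\ \mu_L\cdot(\mathbf 1+x)-\tau\mathbf 1\\ \mu_R\cdot(\mathbf 1-x)-\tau\mathbf 1\end{pmatrix},$$ $$DF(z)=\begin{bmatrix}Q+\omega I&-A^{\mathsf T}&-I&I\\ A&\omega I&0&0\\ \mathrm{diag}(\mu_L)&0&\mathrm{diag}(\mathbf 1+x)&0\\ -\mathrm{diag}(\mu_R)&0&0&\mathrm{diag}(\mathbf 1-x)\end{bmatrix}.$$ $\mathcal{N}(\tau)$ is the set of $z\in\mathbb{R}^N$ with $F_\tau(z)=(0_n,0_m,r^{(3)},r^{(4)})$, $\|(r^{(3)},r^{(4)})\|_2\le\theta\tau$, $\|x\|_\infty<1$, $\mu_L>0$, $\mu_R>0$; and $\mathcal{N}(\tau,\nu)=\{\tilde z\in\mathbb{R}^N:\exists z\in\mathcal{N}(\tau),\ \|\tilde z-z\|_2\le\nu\}$. Rounding model: computing a step $\tilde z+\Delta\tilde z$ with $DF(\tilde z)\Delta\tilde z=-r$ on an IEEE machine with unit roundoff $\varepsilon_{mach}$ and a numerically stable algorithm means that the computed vector equals $\tilde z-DF(\tilde z)^{-1}r+e$ with a rounding error $e\in\mathbb{R}^N$ obeying $\|e\|_2\le const\cdot C_z\cdot\kappa_{DF}\cdot\varepsilon_{mach}$, where $const$ depends only on the linear system solver. *)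

theory Defs
  imports "HOL-Analysis.Analysis"
begin

definition pos_semidef :: "real^'n^'n \<Rightarrow> bool" where
  "pos_semidef Q \<longleftrightarrow> (\<forall>v. 0 \<le> v \<bullet> (Q *v v))"

text \<open>
  Norms: on \<^typ>\<open>real^'n\<close> the library's \<^const>\<open>norm\<close> is the Euclidean norm and on
  \<^typ>\<open>real^'n^'m\<close> it is the Frobenius norm. The spectral norm is the operator norm of
  \<open>x \<mapsto> A x\<close> with respect to the Euclidean norms.
\<close>

definition spectral_norm :: "real^'n^'m \<Rightarrow> real" where
  "spectral_norm A = onorm ((*v) A)"

definition diag :: "'a::zero^'n \<Rightarrow> 'a^'n^'n" where
  "diag v = (\<chi> i j. if i = j then v $ i else 0)"


text \<open>
  The space \<open>\<real>\<^sup>N\<close>, \<open>N = 3 n + m\<close>, of primal-dual vectors \<open>z = (x, \<lambda>, \<mu>\<^sub>L, \<mu>\<^sub>R)\<close> is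
  \<open>real^('n + 'm + 'n + 'n)\<close> (with \<open>+\<close> nested to the right), \<open>n = CARD('n)\<close> and \<open>m = CARD('m)\<close>.
  The entry type of \<open>stack\<close> is left polymorphic, so that it also stacks block rows of a
  matrix, a matrix being a vector of rows.
\<close>

type_synonym ('n, 'm) idx = "'n + 'm + 'n + 'n"

definition stack ::
  "'a^'n \<Rightarrow> 'a^'m \<Rightarrow> 'a^'n \<Rightarrow> 'a^'n \<Rightarrow> 'a^('n::finite, 'm::finite) idx" where
  "stack u v w y = (\<chi> k. case k of
       Inl i \<Rightarrow> u $ i
     | Inr (Inl j) \<Rightarrow> v $ j
     | Inr (Inr (Inl i)) \<Rightarrow> w $ i
     | Inr (Inr (Inr i)) \<Rightarrow> y $ i)"

definition block_row ::
  "'a^'n^'k \<Rightarrow> 'a^'m^'k \<Rightarrow> 'a^'n^'k \<Rightarrow> 'a^'n^'k \<Rightarrow> 'a^('n::finite, 'm::finite) idx^'k" where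
  "block_row B1 B2 B3 B4 = (\<chi> i. stack (B1 $ i) (B2 $ i) (B3 $ i) (B4 $ i))"

definition part_x :: "real^('n::finite, 'm::finite) idx \<Rightarrow> real^'n" where
  "part_x z = (\<chi> i. z $ Inl i)"

definition part_lam :: "real^('n::finite, 'm::finite) idx \<Rightarrow> real^'m" where
  "part_lam z = (\<chi> j. z $ Inr (Inl j))"

definition part_muL :: "real^('n::finite, 'm::finite) idx \<Rightarrow> real^'n" where
  "part_muL z = (\<chi> i. z $ Inr (Inr (Inl i)))"

definition part_muR :: "real^('n::finite, 'm::finite) idx \<Rightarrow> real^'n" where
  "part_muR z = (\<chi> i. z $ Inr (Inr (Inr i)))"


text \<open>
  On vectors, \<open>*\<close> is the componentwise product and \<open>1\<close> is the all-ones vector; on matrices,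
  \<open>mat k\<close> is \<open>k\<close> times the identity.
\<close>

definition F ::
  "real^'n^'n \<Rightarrow> real^'n \<Rightarrow> real^'n^'m \<Rightarrow> real^'m \<Rightarrow> real \<Rightarrow> real
     \<Rightarrow> real^('n::finite, 'm::finite) idx \<Rightarrow> real^('n, 'm) idx" where
  "F Q c A b \<omega> \<tau> z =
    (let x = part_x z; lam = part_lam z; muL = part_muL z; muR = part_muR z in
     stack (Q *v x + \<omega> *\<^sub>R x + c - transpose A *v lam - muL + muR)
           (A *v x - b + \<omega> *\<^sub>R lam)
           (muL * (1 + x) - \<tau> *\<^sub>R 1)
           (muR * (1 - x) - \<tau> *\<^sub>R 1))"

definition DF ::
  "real^'n^'n \<Rightarrow> real^'n^'m \<Rightarrow> real
     \<Rightarrow> real^('n::finite, 'm::finite) idx \<Rightarrow> real^('n, 'm) idx^('n, 'm) idx" where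
  "DF Q A \<omega> z =
    (let x = part_x z; muL = part_muL z; muR = part_muR z in
     stack (block_row (Q + mat \<omega>)   (- transpose A) (- mat 1)      (mat 1))
           (block_row A             (mat \<omega>)         0              0)
           (block_row (diag muL)    0               (diag (1 + x)) 0)
           (block_row (- diag muR)  0               0              (diag (1 - x))))"

text \<open>
  The neighbourhoods \<open>\<N>(\<tau>)\<close> and \<open>\<N>(\<tau>, \<nu>)\<close>. The norm of the pair \<open>(r3, r4)\<close> is the Euclidean
  one. Positivity of vectors is spelled out, because the library's \<open><\<close> on vectors is not
  strict in every component.
\<close>

definition nbhd ::
  "real^'n^'n \<Rightarrow> real^'n \<Rightarrow> real^'n^'m \<Rightarrow> real^'m \<Rightarrow> real \<Rightarrow> real \<Rightarrow> real
     \<Rightarrow> (real^('n::finite, 'm::finite) idx) set" where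
  "nbhd Q c A b \<omega> \<theta> \<tau> = {z.
     (\<exists>r3 r4. F Q c A b \<omega> \<tau> z = stack 0 0 r3 r4 \<and> norm (r3, r4) \<le> \<theta> * \<tau>) \<and>
     infnorm (part_x z) < 1 \<and>
     (\<forall>i. part_muL z $ i > 0) \<and>
     (\<forall>i. part_muR z $ i > 0)}"

definition nbhd_pert ::
  "real^'n^'n \<Rightarrow> real^'n \<Rightarrow> real^'n^'m \<Rightarrow> real^'m \<Rightarrow> real \<Rightarrow> real \<Rightarrow> real \<Rightarrow> real
     \<Rightarrow> (real^('n::finite, 'm::finite) idx) set" where
  "nbhd_pert Q c A b \<omega> \<theta> \<tau> \<nu> = {zt. \<exists>z \<in> nbhd Q c A b \<omega> \<theta> \<tau>. norm (zt - z) \<le> \<nu>}"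

text \<open>
  Rounding model: \<open>zhat\<close> is a possible result of computing \<open>zt + \<Delta>z\<close>, where \<open>M \<Delta>z = - r\<close>, at unit
  roundoff \<open>\<epsilon>\<close> with a numerically stable solver whose error constant is \<open>C\<^sub>s\<close>.
  Meaningful for invertible \<open>M\<close> only.
\<close>

definition computed_step ::
  "real \<Rightarrow> real \<Rightarrow> real \<Rightarrow> real \<Rightarrow> real^'k^'k \<Rightarrow> real^'k \<Rightarrow> real^'k \<Rightarrow> real^'k \<Rightarrow> bool" where
  "computed_step C\<^sub>s C\<^sub>z \<kappa> \<epsilon> M r zt zhat \<longleftrightarrow>
     (\<exists>e. norm e \<le> C\<^sub>s * C\<^sub>z * \<kappa> * \<epsilon> \<and> zhat = zt - matrix_inv M *v r + e)"

end

theory Submission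
  imports Defs
begin

text \<open>
  Let \<open>z \<in> \<N>(\<tau>)\<close> be a point with \<open>\<parallel>zt - z\<parallel> \<le> \<nu>\<^sub>0\<close>, and compare the computed step from \<open>zt\<close>
  with the exact Newton step \<open>z + d\<close>, \<open>DF(z) d = -F\<^bsub>\<sigma>\<tau>\<^esub>(z)\<close>. Three facts give the theorem.

  \<^item> The exact step lands in \<open>\<N>(\<sigma>\<tau>)\<close> (\<open>newton_step_in_nbhd\<close>). As \<open>F\<close> is quadratic, the residual of
    \<open>F\<^bsub>\<sigma>\<tau>\<^esub>\<close> at \<open>z + d\<close> consists only of the products of the increments of slacks and multipliers.
    Monotonicity (\<open>Q\<close> is positive semidefinite) makes the sum of these products nonnegative,
    so that the positive ones, bounded by the arithmetic-geometric mean inequality, control the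
    negative ones; this is the classical argument for short-step path following.

  \<^item> All points in the \<open>\<nu>\<^sub>0\<close>-ball around \<open>z\<close> have \<open>\<parallel>DF\<^sup>-\<^sup>1\<parallel> \<le> C_DFinv\<close> (\<open>DF_lower_bound\<close>): dividing the last
    two block rows by \<open>\<mu>\<^sub>L\<close> and \<open>\<mu>\<^sub>R\<close> turns \<open>DF\<close> into a matrix whose symmetric part is block diagonal
    and bounded below. The sizes of \<open>z\<close>, of its slacks and of its multipliers that this needs are
    in \<open>nbhd_norm_le\<close> and \<open>nbhd_gap\<close>.

  \<^item> The two Newton iterates differ by a vector that \<open>DF(zt)\<close> maps to a combination of
    products involving \<open>z - zt\<close> (\<open>newton_perturbation\<close>), so their distance is at most
    \<open>C_DFinv (2\<parallel>d\<parallel> + \<nu>\<^sub>0) \<nu>\<^sub>0 \<le> (C\<^sub>\<nu> - 1) \<nu>\<^sub>0\<close>, because \<open>\<parallel>d\<parallel> \<le> 2 C\<^sub>z\<close>.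

  Since \<open>\<nu>\<^sub>1 \<ge> C\<^sub>\<nu> \<nu>\<^sub>0\<close>, a rounding error of size \<open>\<nu>\<^sub>0\<close> is still affordable, and this determines \<open>\<epsilon>\<^sub>0\<close>.
\<close>

section \<open>Block vectors and matrices\<close>

lemma sum_idx:
  fixes f :: "('n::finite, 'm::finite) idx \<Rightarrow> 'a::comm_monoid_add"
  shows "(\<Sum>k\<in>UNIV. f k) = (\<Sum>i\<in>UNIV. f (Inl i)) + ((\<Sum>j\<in>UNIV. f (Inr (Inl j))) +
     ((\<Sum>i\<in>UNIV. f (Inr (Inr (Inl i)))) + (\<Sum>i\<in>UNIV. f (Inr (Inr (Inr i))))))"
  by (simp add: UNIV_Plus_UNIV [symmetric] sum.Plus comp_def del: UNIV_Plus_UNIV)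

lemma parts_stack [simp]:
  "part_x (stack u v w y) = u" "part_lam (stack u v w y) = v"
  "part_muL (stack u v w y) = w" "part_muR (stack u v w y) = y"
  by (simp_all add: part_x_def part_lam_def part_muL_def part_muR_def stack_def vec_eq_iff)

lemma parts_linear [simp]:
  "part_x (z + w) = part_x z + part_x w" "part_lam (z + w) = part_lam z + part_lam w"
  "part_muL (z + w) = part_muL z + part_muL w" "part_muR (z + w) = part_muR z + part_muR w"
  "part_x (z - w) = part_x z - part_x w" "part_lam (z - w) = part_lam z - part_lam w"
  "part_muL (z - w) = part_muL z - part_muL w" "part_muR (z - w) = part_muR z - part_muR w"
  "part_x (- w) = - part_x w" "part_lam (- w) = - part_lam w"
  "part_muL (- w) = - part_muL w" "part_muR (- w) = - part_muR w"
  "part_x 0 = 0" "part_lam 0 = 0" "part_muL 0 = 0" "part_muR 0 = 0"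
  by (simp_all add: part_x_def part_lam_def part_muL_def part_muR_def vec_eq_iff)

lemma parts_eqI:
  assumes "part_x z = part_x w" "part_lam z = part_lam w"
    "part_muL z = part_muL w" "part_muR z = part_muR w"
  shows "z = w"
  using assms
  by (simp add: part_x_def part_lam_def part_muL_def part_muR_def vec_eq_iff split_sum_all)

lemma inner_parts:
  "z \<bullet> w = part_x z \<bullet> part_x w + part_lam z \<bullet> part_lam w
     + part_muL z \<bullet> part_muL w + part_muR z \<bullet> part_muR w"
  by (simp add: inner_vec_def sum_idx part_x_def part_lam_def part_muL_def part_muR_def)

lemma norm_sq_parts:
  "(norm z)\<^sup>2 = (norm (part_x z))\<^sup>2 + (norm (part_lam z))\<^sup>2
     + (norm (part_muL z))\<^sup>2 + (norm (part_muR z))\<^sup>2"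
  by (simp add: power2_norm_eq_inner inner_parts)

lemma diag_mult: fixes v :: "real^'n" shows "diag v *v x = v * x"
  by (simp add: diag_def matrix_vector_mult_def vec_eq_iff if_distrib[of "\<lambda>t. t * _"] cong: if_cong)

lemma mat_mult: fixes x :: "real^'n" shows "mat k *v x = k *\<^sub>R x"
  by (simp add: mat_def matrix_vector_mult_def vec_eq_iff if_distrib[of "\<lambda>t. t * _"] cong: if_cong)

lemma block_row_mult:
  "block_row B1 B2 B3 B4 *v d =
     B1 *v part_x d + B2 *v part_lam d + B3 *v part_muL d + B4 *v part_muR d"
  by (simp add: block_row_def stack_def matrix_vector_mult_def vec_eq_iff sum_idx
      part_x_def part_lam_def part_muL_def part_muR_def add.assoc)

lemma stack_mult:
  "stack B1 B2 B3 B4 *v d = stack (B1 *v d) (B2 *v d) (B3 *v d) (B4 *v d)"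
  by (simp add: stack_def matrix_vector_mult_def vec_eq_iff split: sum.split)

lemma uminus_mult: fixes B :: "real^'n^'m" shows "(- B) *v x = - (B *v x)"
  by (simp add: matrix_vector_mult_def vec_eq_iff sum_negf)

lemma zero_mult: fixes x :: "real^'n" shows "(0 :: real^'n^'m) *v x = 0"
  by (simp add: matrix_vector_mult_def vec_eq_iff)

lemma DF_mult:
  "DF Q A \<omega> z *v d = stack
     (Q *v part_x d + \<omega> *\<^sub>R part_x d - transpose A *v part_lam d - part_muL d + part_muR d)
     (A *v part_x d + \<omega> *\<^sub>R part_lam d)
     (part_muL z * part_x d + (1 + part_x z) * part_muL d)
     (- (part_muR z * part_x d) + (1 - part_x z) * part_muR d)"
  by (simp add: DF_def Let_def stack_mult block_row_mult diag_mult mat_mult uminus_mult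
      matrix_vector_mult_add_rdistrib zero_mult)

section \<open>The system and its neighbourhoods\<close>

lemma infnorm_less_iff:
  fixes x :: "real^'n"
  shows "infnorm x < 1 \<longleftrightarrow> (\<forall>i. - 1 < x $ i \<and> x $ i < 1)"
proof -
  have "{\<bar>x $ i\<bar> | i. i \<in> UNIV} = range (\<lambda>i. \<bar>x $ i\<bar>)" by auto
  then have "infnorm x = Max (range (\<lambda>i. \<bar>x $ i\<bar>))"
    unfolding infnorm_cart by (simp add: cSup_eq_Max)
  then have "infnorm x < 1 \<longleftrightarrow> (\<forall>i. \<bar>x $ i\<bar> < 1)"
    by simp
  then show ?thesis by (simp add: abs_less_iff) (smt (verit))
qed

lemma F_parts:
  "part_x (F Q c A b \<omega> \<tau> z) = Q *v part_x z + \<omega> *\<^sub>R part_x z + c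
     - transpose A *v part_lam z - part_muL z + part_muR z"
  "part_lam (F Q c A b \<omega> \<tau> z) = A *v part_x z - b + \<omega> *\<^sub>R part_lam z"
  "part_muL (F Q c A b \<omega> \<tau> z) = part_muL z * (1 + part_x z) - \<tau> *\<^sub>R 1"
  "part_muR (F Q c A b \<omega> \<tau> z) = part_muR z * (1 - part_x z) - \<tau> *\<^sub>R 1"
  by (simp_all add: F_def Let_def)

lemma nbhd_iff:
  "z \<in> nbhd Q c A b \<omega> \<theta> \<tau> \<longleftrightarrow>
     part_x (F Q c A b \<omega> \<tau> z) = 0 \<and> part_lam (F Q c A b \<omega> \<tau> z) = 0 \<and>
     norm (part_muL (F Q c A b \<omega> \<tau> z), part_muR (F Q c A b \<omega> \<tau> z)) \<le> \<theta> * \<tau> \<and>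
     (\<forall>i. - 1 < part_x z $ i \<and> part_x z $ i < 1 \<and> part_muL z $ i > 0 \<and> part_muR z $ i > 0)"
proof -
  have "F Q c A b \<omega> \<tau> z = stack 0 0 r3 r4 \<longleftrightarrow> part_x (F Q c A b \<omega> \<tau> z) = 0 \<and> part_lam (F Q c A b \<omega> \<tau> z) = 0
     \<and> r3 = part_muL (F Q c A b \<omega> \<tau> z) \<and> r4 = part_muR (F Q c A b \<omega> \<tau> z)" for r3 r4
    by (auto intro!: parts_eqI)
  then show ?thesis
    unfolding nbhd_def mem_Collect_eq infnorm_less_iff by auto
qed

text \<open>
  The bilinear part of \<open>F\<close>, in non-symmetrised form: multipliers are taken from \<open>d\<close>, slacks from
  \<open>e\<close>. An increment \<open>e\<close> changes the slacks \<open>1 + x\<close> and \<open>1 - x\<close> by \<open>part_x e\<close> and \<open>- part_x e\<close>.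
\<close>

definition slack_product :: "real^('n::finite, 'm::finite) idx \<Rightarrow> real^('n, 'm) idx
    \<Rightarrow> real^('n, 'm) idx" where
  "slack_product d e = stack 0 0 (part_muL d * part_x e) (- (part_muR d * part_x e))"

lemma norm_times_le: fixes a b :: "real^'n" shows "norm (a * b) \<le> norm a * norm b"
proof -
  have "(norm (a * b))\<^sup>2 = (\<Sum>i\<in>UNIV. (a $ i)\<^sup>2 * (b $ i)\<^sup>2)"
    unfolding power2_norm_eq_inner inner_vec_def by (simp add: power2_eq_square mult_ac)
  also have "\<dots> \<le> (\<Sum>i\<in>UNIV. (a $ i)\<^sup>2 * (norm b)\<^sup>2)"
    by (intro sum_mono mult_left_mono power2_le_iff_abs_le[THEN iffD2] component_le_norm_cart) auto
  also have "\<dots> = (norm a * norm b)\<^sup>2"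
    unfolding sum_distrib_right[symmetric] power_mult_distrib power2_norm_eq_inner[of a] inner_vec_def
    by (simp add: power2_eq_square)
  finally show ?thesis by (rule power2_le_imp_le) simp
qed

lemma norm_slack_product_le: "norm (slack_product d e) \<le> norm d * norm e"
proof -
  have "(norm (slack_product d e))\<^sup>2 \<le> (norm (part_muL d) * norm (part_x e))\<^sup>2 + (norm (part_muR d) * norm (part_x e))\<^sup>2"
    unfolding slack_product_def norm_sq_parts by (simp add: power_mono norm_times_le add_mono)
  also have "\<dots> = ((norm (part_muL d))\<^sup>2 + (norm (part_muR d))\<^sup>2) * (norm (part_x e))\<^sup>2"
    by (simp add: power_mult_distrib algebra_simps)
  also have "\<dots> \<le> (norm d)\<^sup>2 * (norm e)\<^sup>2"
    by (intro mult_mono) (auto simp: norm_sq_parts)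
  finally show ?thesis by (simp add: power_mult_distrib[symmetric] power2_le_iff_abs_le)
qed

lemma F_expansion:
  "F Q c A b \<omega> \<tau> (z + d) = F Q c A b \<omega> \<tau> z + DF Q A \<omega> z *v d + slack_product d d"
  by (rule parts_eqI)
    (simp_all add: F_parts DF_mult slack_product_def matrix_vector_right_distrib vector_matrix_left_distrib
      vec_eq_iff, simp_all add: algebra_simps)

section \<open>A bound on the inverse Jacobian\<close>

text \<open>
  After division of the last two block rows by \<open>\<mu>\<^sub>L\<close> and \<open>\<mu>\<^sub>R\<close> the off-diagonal blocks are
  skew-symmetric, so the quadratic form of the scaled matrix is that of its diagonal blocks
  \<open>Q + \<omega> I\<close>, \<open>\<omega> I\<close>, \<open>(1 + x) / \<mu>\<^sub>L\<close> and \<open>(1 - x) / \<mu>\<^sub>R\<close>. It is at least \<open>min \<omega> (g / K)\<close>, and the scaling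
  itself costs a factor \<open>1 / g\<close>.
\<close>

lemma DF_lower_bound:
  assumes psd: "pos_semidef Q" and \<omega>: "0 < \<omega>" and g: "0 < g" "g \<le> 1" and K: "0 < K"
    and z: "\<And>i. g \<le> 1 + part_x z $ i" "\<And>i. g \<le> 1 - part_x z $ i"
      "\<And>i. g \<le> part_muL z $ i" "\<And>i. g \<le> part_muR z $ i"
      "\<And>i. part_muL z $ i \<le> K" "\<And>i. part_muR z $ i \<le> K"
  shows "norm d \<le> 1 / g * max (1 / \<omega>) (K / g) * norm (DF Q A \<omega> z *v d)"
proof -
  define r where "r = DF Q A \<omega> z *v d"
  \<comment> \<open>\<open>s\<close> is the image of \<open>d\<close> under the scaled matrix.\<close>
  define s where "s = stack (part_x r) (part_lam r) (\<chi> i. part_muL r $ i / part_muL z $ i)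
     (\<chi> i. part_muR r $ i / part_muR z $ i)"
  define p where "p = min \<omega> (g / K)"
  have p: "p > 0" "max (1 / \<omega>) (K / g) = 1 / p" using \<omega> g K
    by (auto simp: p_def max_def min_def field_simps)
  have pos: "part_muL z $ i > 0" "part_muR z $ i > 0" for i using z(3,4)[of i] g by auto
  have quot: "g / K \<le> a / m" if "g \<le> a" "m \<le> K" "m > 0" for a m
    using that g K by (intro frac_le) auto
  have w: "p * v\<^sup>2 \<le> a / m * v\<^sup>2" if "g \<le> a" "m \<le> K" "m > 0" for a m v
    using quot[OF that] by (intro mult_right_mono) (auto simp: p_def)
  have adj: "part_x d \<bullet> (part_lam d v* A) = part_lam d \<bullet> (A *v part_x d)"
    by (simp add: inner_commute[of "part_x d"] dot_lmul_matrix)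
  have "part_muL d \<bullet> part_muL s = part_muL d \<bullet> part_x d
       + (\<Sum>i\<in>UNIV. (1 + part_x z $ i) / part_muL z $ i * (part_muL d $ i)\<^sup>2)"
    using pos(1) unfolding inner_vec_def sum.distrib[symmetric]
    by (intro sum.cong) (simp_all add: s_def r_def DF_mult field_simps power2_eq_square less_imp_neq[symmetric])
  moreover have "part_muR d \<bullet> part_muR s = - (part_muR d \<bullet> part_x d)
       + (\<Sum>i\<in>UNIV. (1 - part_x z $ i) / part_muR z $ i * (part_muR d $ i)\<^sup>2)"
    using pos(2) unfolding inner_vec_def sum_negf[symmetric] sum.distrib[symmetric]
    by (intro sum.cong) (simp_all add: s_def r_def DF_mult field_simps power2_eq_square less_imp_neq[symmetric])
  moreover have "part_x d \<bullet> part_x s = part_x d \<bullet> (Q *v part_x d) + \<omega> * (norm (part_x d))\<^sup>2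
       - part_lam d \<bullet> (A *v part_x d) - part_muL d \<bullet> part_x d + part_muR d \<bullet> part_x d"
    by (simp add: s_def r_def DF_mult inner_add_right inner_diff_right adj power2_norm_eq_inner
        inner_commute[of "part_x d" "part_muL d"] inner_commute[of "part_x d" "part_muR d"])
  moreover have "part_lam d \<bullet> part_lam s = part_lam d \<bullet> (A *v part_x d) + \<omega> * (norm (part_lam d))\<^sup>2"
    by (simp add: s_def r_def DF_mult inner_add_right power2_norm_eq_inner)
  moreover have "p * (norm (part_muL d))\<^sup>2 \<le> (\<Sum>i\<in>UNIV. (1 + part_x z $ i) / part_muL z $ i * (part_muL d $ i)\<^sup>2)"
    unfolding power2_norm_eq_inner inner_vec_def sum_distrib_left
    using w z pos by (intro sum_mono) (simp add: power2_eq_square)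
  moreover have "p * (norm (part_muR d))\<^sup>2 \<le> (\<Sum>i\<in>UNIV. (1 - part_x z $ i) / part_muR z $ i * (part_muR d $ i)\<^sup>2)"
    unfolding power2_norm_eq_inner inner_vec_def sum_distrib_left
    using w z pos by (intro sum_mono) (simp add: power2_eq_square)
  moreover have "p * (norm (part_x d))\<^sup>2 \<le> \<omega> * (norm (part_x d))\<^sup>2" "p * (norm (part_lam d))\<^sup>2 \<le> \<omega> * (norm (part_lam d))\<^sup>2"
    by (auto simp: p_def intro!: mult_right_mono)
  moreover have "0 \<le> part_x d \<bullet> (Q *v part_x d)" using psd by (simp add: pos_semidef_def)
  ultimately have "p * (norm d)\<^sup>2 \<le> d \<bullet> s"
    by (simp add: norm_sq_parts inner_parts distrib_left)
  also have "\<dots> \<le> norm d * norm s" by (rule norm_cauchy_schwarz)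
  finally have 1: "p * norm d \<le> norm s"
    by (cases "norm d = 0") (auto simp: power2_eq_square)
  have div: "norm (\<chi> i. a $ i / m $ i) \<le> norm a / g" if "\<And>i. g \<le> m $ i" for a m :: "real^'a"
  proof -
    have "\<bar>a $ i\<bar> / \<bar>m $ i\<bar> \<le> \<bar>a $ i\<bar> / g" for i
      using that[of i] g by (intro frac_le) auto
    then have "norm (\<chi> i. a $ i / m $ i) \<le> norm ((1 / g) *\<^sub>R a)"
      using g by (intro norm_le_componentwise_cart) (simp add: abs_mult)
    then show ?thesis using g by simp
  qed
  have "(norm s)\<^sup>2 \<le> (norm r / g)\<^sup>2"
  proof -
    have one: "t \<le> t / g" if "t \<ge> 0" for t using that g by (simp add: pos_le_divide_eq mult_left_le)
    have "(norm s)\<^sup>2 \<le> (norm (part_x r) / g)\<^sup>2 + (norm (part_lam r) / g)\<^sup>2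
     + (norm (part_muL r) / g)\<^sup>2 + (norm (part_muR r) / g)\<^sup>2"
      unfolding norm_sq_parts[of s] using z
      by (intro add_mono power_mono) (auto simp: s_def intro!: one div)
    also have "\<dots> = (norm r / g)\<^sup>2"
      by (simp add: norm_sq_parts[of r] power_divide add_divide_distrib)
    finally show ?thesis .
  qed
  then have "norm s \<le> norm r / g" by (rule power2_le_imp_le) (use g in simp)
  with 1 have "p * norm d \<le> norm r / g" by linarith
  then have "norm d \<le> norm r / g / p" using p(1) by (simp add: pos_le_divide_eq mult.commute del: divide_divide_eq_left)
  then show ?thesis unfolding p(2) r_def[symmetric] by (simp add: field_simps)
qed


lemma invertible_if_bounded_below:
  fixes M :: "real^'k^'k"
  assumes "\<And>d. norm d \<le> L * norm (M *v d)"
  shows "invertible M"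
proof -
  have "M *v d = 0 \<Longrightarrow> d = 0" for d using assms[of d] by simp
  then show ?thesis
    by (simp add: invertible_left_inverse matrix_left_invertible_ker)
qed


section \<open>Size and gap of neighbourhood points\<close>

lemma abs_part_le_norm:
  "\<bar>part_x d $ i\<bar> \<le> norm d" "\<bar>part_muL d $ i\<bar> \<le> norm d" "\<bar>part_muR d $ i\<bar> \<le> norm d"
  by (simp_all add: part_x_def part_muL_def part_muR_def component_le_norm_cart)

lemma spectral_norm_nonneg: "0 \<le> spectral_norm A"
  unfolding spectral_norm_def by (intro onorm_pos_le matrix_vector_mul_bounded_linear)

lemma norm_mult_le_spectral_norm: "norm (A *v x) \<le> spectral_norm A * norm x"
  unfolding spectral_norm_def by (intro onorm matrix_vector_mul_bounded_linear)

lemma norm_transpose_mult_le_spectral_norm: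
  fixes A :: "real^'n^'m"
  shows "norm (y v* A) \<le> spectral_norm A * norm y"
proof -
  have "norm (y v* A) * norm (y v* A) = y \<bullet> (A *v (y v* A))"
    by (simp add: dot_lmul_matrix[symmetric] power2_norm_eq_inner[symmetric] power2_eq_square)
  also have "\<dots> \<le> norm y * (spectral_norm A * norm (y v* A))"
    by (intro order.trans[OF norm_cauchy_schwarz] mult_left_mono norm_mult_le_spectral_norm) simp
  finally show ?thesis
    by (cases "norm (y v* A) = 0") (auto simp: spectral_norm_nonneg mult_ac)
qed

lemma nbhd_complementarity:
  assumes "z \<in> nbhd Q c A b \<omega> \<theta> \<tau>"
  shows "\<bar>part_muL z $ i * (1 + part_x z $ i) - \<tau>\<bar> \<le> \<theta> * \<tau>"
    "\<bar>part_muR z $ i * (1 - part_x z $ i) - \<tau>\<bar> \<le> \<theta> * \<tau>"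
proof -
  let ?L = "part_muL (F Q c A b \<omega> \<tau> z)" and ?R = "part_muR (F Q c A b \<omega> \<tau> z)"
  have "norm (?L, ?R) \<le> \<theta> * \<tau>" using assms by (simp add: nbhd_iff)
  then have "norm ?L \<le> \<theta> * \<tau>" "norm ?R \<le> \<theta> * \<tau>"
    using norm_fst_le[of ?L ?R] norm_snd_le[of ?R ?L] by linarith+
  then have "\<bar>?L $ i\<bar> \<le> \<theta> * \<tau>" "\<bar>?R $ i\<bar> \<le> \<theta> * \<tau>"
    using component_le_norm_cart order.trans by blast+
  then show "\<bar>part_muL z $ i * (1 + part_x z $ i) - \<tau>\<bar> \<le> \<theta> * \<tau>"
    "\<bar>part_muR z $ i * (1 - part_x z $ i) - \<tau>\<bar> \<le> \<theta> * \<tau>" by (simp_all add: F_parts)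
qed

lemma norm_sq_le_card:
  fixes v :: "real^'n"
  assumes "\<And>i. \<bar>v $ i\<bar> \<le> B"
  shows "(norm v)\<^sup>2 \<le> real CARD('n) * B\<^sup>2"
proof -
  have "(norm v)\<^sup>2 = (\<Sum>i\<in>UNIV. (v $ i)\<^sup>2)"
    unfolding power2_norm_eq_inner inner_vec_def by (simp add: power2_eq_square)
  also have "\<dots> \<le> (\<Sum>i\<in>(UNIV :: 'n set). B\<^sup>2)"
    using assms by (intro sum_mono abs_le_square_iff[THEN iffD1]) (meson abs_ge_self order.trans)
  finally show ?thesis by simp
qed

text \<open>
  The second equation bounds \<open>\<lambda>\<close>, the first one \<open>\<mu>\<^sub>L - \<mu>\<^sub>R\<close>. In each coordinate one of the slacks is
  at least 1, so complementarity bounds the multiplier belonging to it by \<open>(1 + \<theta>) \<tau>\<close>, and the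
  bound on the difference carries over to the other multiplier.
\<close>

lemma nbhd_norm_le:
  fixes Q :: "real^'n^'n" and A :: "real^'n^'m"
  defines "n \<equiv> real CARD('n)"
  assumes z: "z \<in> nbhd Q c A b \<omega> \<theta> \<tau>" and pos: "0 < \<omega>" "0 \<le> \<theta>" "\<tau> \<le> T"
    and C1: "(spectral_norm A * sqrt n + norm b) / \<omega> \<le> C1"
    and C2: "(\<omega> + spectral_norm Q) * sqrt n + norm c + spectral_norm A * C1 \<le> C2"
    and C3: "sqrt (2 * n) * (C2 + (1 + \<theta>) * T) \<le> C3"
  shows "norm z \<le> sqrt (n + C1\<^sup>2 + C3\<^sup>2)"
proof -
  define x l p q where "x = part_x z" and "l = part_lam z" and "p = part_muL z" and "q = part_muR z"
  have box: "- 1 < x $ i" "x $ i < 1" "p $ i > 0" "q $ i > 0" for i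
    using z by (simp_all add: nbhd_iff x_def p_def q_def)
  have nx: "(norm x)\<^sup>2 \<le> n" using norm_sq_le_card[of x 1] box
    by (simp add: n_def abs_le_iff less_imp_le minus_le_iff)
  then have x: "norm x \<le> sqrt n" by (simp add: real_le_rsqrt)
  have "\<omega> *\<^sub>R l = b - A *v x"
    using z by (simp add: nbhd_iff F_parts x_def l_def algebra_simps)
  then have "\<omega> * norm l = norm (b - A *v x)" using pos by (metis abs_of_pos norm_scaleR)
  also have "\<dots> \<le> norm b + spectral_norm A * sqrt n"
    by (intro order.trans[OF norm_triangle_ineq4] add_mono order.refl
        order.trans[OF norm_mult_le_spectral_norm] mult_left_mono x spectral_norm_nonneg)
  finally have l: "norm l \<le> C1" using C1 pos
    by (simp add: pos_divide_le_eq) (smt (verit) mult.commute mult_le_cancel_right_pos)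
  have d: "p - q = Q *v x + \<omega> *\<^sub>R x + c - l v* A"
    using z by (simp add: nbhd_iff F_parts x_def l_def p_def q_def algebra_simps)
  have "norm (p - q) \<le> spectral_norm Q * sqrt n + \<omega> * sqrt n + norm c + spectral_norm A * C1"
    unfolding d
    by (intro order.trans[OF norm_triangle_ineq4] order.trans[OF norm_triangle_ineq] add_mono order.refl
        order.trans[OF norm_mult_le_spectral_norm] order.trans[OF norm_transpose_mult_le_spectral_norm]
        mult_left_mono x l spectral_norm_nonneg) (use pos x in simp)
  then have "norm (p - q) \<le> C2" using C2 by (simp add: algebra_simps)
  then have pq: "\<bar>p $ i - q $ i\<bar> \<le> C2" for i
    using component_le_norm_cart[of "p - q" i] by simp
  have T: "(1 + \<theta>) * \<tau> \<le> (1 + \<theta>) * T" using pos by (intro mult_left_mono) auto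
  have B: "p $ i \<le> C2 + (1 + \<theta>) * T \<and> q $ i \<le> C2 + (1 + \<theta>) * T" for i
  proof (cases "x $ i \<ge> 0")
    case True
    then have "p $ i * 1 \<le> p $ i * (1 + x $ i)" using box[of i] by (intro mult_left_mono) auto
    moreover have "p $ i * (1 + x $ i) \<le> (1 + \<theta>) * \<tau>"
      using nbhd_complementarity(1)[OF z, of i] by (simp add: x_def p_def distrib_right abs_le_iff)
    ultimately show ?thesis using pq[of i] T by linarith
  next
    case False
    then have "q $ i * 1 \<le> q $ i * (1 - x $ i)" using box[of i] by (intro mult_left_mono) auto
    moreover have "q $ i * (1 - x $ i) \<le> (1 + \<theta>) * \<tau>"
      using nbhd_complementarity(2)[OF z, of i] by (simp add: x_def q_def distrib_right abs_le_iff)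
    ultimately show ?thesis using pq[of i] T by linarith
  qed
  have "(norm p)\<^sup>2 \<le> n * (C2 + (1 + \<theta>) * T)\<^sup>2" "(norm q)\<^sup>2 \<le> n * (C2 + (1 + \<theta>) * T)\<^sup>2"
    unfolding n_def using B box less_imp_le by (intro norm_sq_le_card; simp add: abs_of_pos)+
  then have "(norm p)\<^sup>2 + (norm q)\<^sup>2 \<le> (sqrt (2 * n) * (C2 + (1 + \<theta>) * T))\<^sup>2"
    by (simp add: power_mult_distrib n_def)
  also have "\<dots> \<le> C3\<^sup>2"
    using B box[of undefined] C3 by (intro power_mono mult_nonneg_nonneg) (auto simp: n_def intro: less_imp_le order.trans)
  finally have "(norm z)\<^sup>2 \<le> n + C1\<^sup>2 + C3\<^sup>2"
    using nx power_mono[OF l norm_ge_zero, of 2] unfolding norm_sq_parts[of z] x_def l_def p_def q_def by simp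
  then show ?thesis by (rule real_le_rsqrt)
qed

text \<open>
  In each product slack times multiplier, which is at least \<open>(1 - \<theta>) \<tau>\<close>, neither factor exceeds
  \<open>1 + K\<close>, whence both are bounded below.
\<close>

lemma nbhd_gap:
  assumes z: "z \<in> nbhd Q c A b \<omega> \<theta> \<tau>" and K: "norm z \<le> K" "1 \<le> K"
    and \<theta>: "\<theta> < 1" and \<tau>: "0 < \<tau>" and g: "g \<le> (1 - \<theta>) / (1 + K) * \<tau>"
  shows "g \<le> 1 + part_x z $ i" "g \<le> 1 - part_x z $ i" "g \<le> part_muL z $ i" "g \<le> part_muR z $ i"
proof -
  have gap: "g \<le> s" if "\<bar>m * s - \<tau>\<bar> \<le> \<theta> * \<tau>" "m \<le> 1 + K" "0 < s" for m s
  proof -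
    have "(1 - \<theta>) * \<tau> \<le> m * s" using that(1) by (simp add: left_diff_distrib)
    also have "\<dots> \<le> (1 + K) * s" using that by simp
    finally have "(1 - \<theta>) / (1 + K) * \<tau> \<le> s" using K by (simp add: field_simps)
    with g show ?thesis by simp
  qed
  have box: "- 1 < part_x z $ i" "part_x z $ i < 1" "part_muL z $ i > 0" "part_muR z $ i > 0"
    using z by (simp_all add: nbhd_iff)
  have mu: "part_muL z $ i \<le> K" "part_muR z $ i \<le> K"
    using abs_part_le_norm(2,3)[of z i] K by auto
  note c = nbhd_complementarity[OF z, of i]
  show "g \<le> 1 + part_x z $ i" by (rule gap[OF c(1)]) (use mu box in auto)
  show "g \<le> 1 - part_x z $ i" by (rule gap[OF c(2)]) (use mu box in auto)
  show "g \<le> part_muL z $ i" by (rule gap[where m = "1 + part_x z $ i"]) (use c box K in \<open>auto simp: mult.commute\<close>)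
  show "g \<le> part_muR z $ i" by (rule gap[where m = "1 - part_x z $ i"]) (use c box K in \<open>auto simp: mult.commute\<close>)
qed

section \<open>The exact Newton step\<close>

text \<open>
  The negative terms are in total no larger than the positive ones, and the latter are bounded
  by the sum of the \<open>q i\<close>; a sum of squares of terms of one sign is at most the square of their sum.
\<close>

lemma sum_squares_le_of_sum_nonneg:
  fixes p q :: "'a \<Rightarrow> real"
  assumes "0 \<le> (\<Sum>i\<in>I. p i)" and pq: "\<And>i. i \<in> I \<Longrightarrow> p i \<le> q i" "\<And>i. i \<in> I \<Longrightarrow> 0 \<le> q i"
  shows "(\<Sum>i\<in>I. (p i)\<^sup>2) \<le> 2 * (\<Sum>i\<in>I. q i)\<^sup>2"
proof -
  have sq: "(\<Sum>i\<in>I. (f i)\<^sup>2) \<le> (\<Sum>i\<in>I. f i)\<^sup>2" if "\<And>i. 0 \<le> f i" for f :: "'a \<Rightarrow> real"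
  proof -
    have "(L2_set f I)\<^sup>2 \<le> (\<Sum>i\<in>I. f i)\<^sup>2"
      using that by (intro power_mono L2_set_le_sum) auto
    then show ?thesis using that by (simp add: L2_set_def sum_nonneg)
  qed
  define P N where "P = (\<Sum>i\<in>I. max (p i) 0)" and "N = (\<Sum>i\<in>I. max (- p i) 0)"
  have "P - N = (\<Sum>i\<in>I. p i)" unfolding P_def N_def sum_subtractf[symmetric]
    by (intro sum.cong) (auto simp: max_def)
  with assms have NP: "N \<le> P" by simp
  have N0: "0 \<le> N" unfolding N_def by (intro sum_nonneg) auto
  have Pq: "P \<le> (\<Sum>i\<in>I. q i)" unfolding P_def using pq by (intro sum_mono) auto
  have "(\<Sum>i\<in>I. (p i)\<^sup>2) = (\<Sum>i\<in>I. (max (p i) 0)\<^sup>2) + (\<Sum>i\<in>I. (max (- p i) 0)\<^sup>2)"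
    unfolding sum.distrib[symmetric] by (intro sum.cong) (auto simp: max_def)
  also have "\<dots> \<le> P\<^sup>2 + N\<^sup>2" unfolding P_def N_def by (intro add_mono sq) auto
  also have "\<dots> \<le> 2 * P\<^sup>2" using power_mono[OF NP N0, of 2] by simp
  also have "\<dots> \<le> 2 * (\<Sum>i\<in>I. q i)\<^sup>2" using NP N0 Pq by (intro mult_left_mono power_mono) auto
  finally show ?thesis .
qed

text \<open>
  The new product is positive, so the new values have equal signs; they are not both negative,
  because the linearised equation gives \<open>(s + ds) m + s (m + dm) = m s + t > 0\<close>.
\<close>

lemma newton_step_positive:
  fixes s m ds dm t :: real
  assumes "0 < s" "0 < m" "0 < t" and newton: "m * ds + s * dm = t - m * s" and "- t < ds * dm"
  shows "0 < s + ds" "0 < m + dm"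
proof -
  have prod: "0 < (s + ds) * (m + dm)" using newton assms(5) by (simp add: algebra_simps)
  have "(s + ds) * m + s * (m + dm) = m * s + t" using newton by (simp add: algebra_simps)
  then have "0 < (s + ds) * m + s * (m + dm)" using assms(1-3) by (simp add: add_pos_pos)
  then have "\<not> (s + ds < 0 \<and> m + dm < 0)" using assms(1,2)
    by (meson add_neg_neg mult_neg_pos mult_pos_neg not_less_iff_gr_or_eq)
  then show "0 < s + ds" "0 < m + dm" using prod by (auto simp: zero_less_mult_iff)
qed

lemma newton_step_in_nbhd:
  fixes Q :: "real^'n^'n" and A :: "real^'n^'m"
  defines "n \<equiv> real CARD('n)"
  assumes psd: "pos_semidef Q" and \<omega>: "0 < \<omega>" and \<theta>: "0 < \<theta>" "\<theta> \<le> 0.3" and \<tau>: "0 < \<tau>"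
    and \<sigma>: "1 - \<theta> / sqrt (2 * n) \<le> \<sigma>" "\<sigma> < 1"
    and z: "z \<in> nbhd Q c A b \<omega> \<theta> \<tau>"
    and newton: "F Q c A b \<omega> (\<sigma> * \<tau>) z + DF Q A \<omega> z *v d = 0"
  shows "z + d \<in> nbhd Q c A b \<omega> \<theta> (\<sigma> * \<tau>)"
proof -
  have n: "1 \<le> n" unfolding n_def by (simp add: Suc_leI)
  then have "\<theta> / sqrt (2 * n) \<le> \<theta> / 1" using \<theta> by (intro divide_left_mono) auto
  then have \<sigma>7: "0.7 \<le> \<sigma>" using \<sigma> \<theta> by simp
  have F': "F Q c A b \<omega> (\<sigma> * \<tau>) (z + d) = slack_product d d"
    unfolding F_expansion using newton by simp
  \<comment> \<open>\<open>pL\<close>, \<open>pR\<close>: products of increments, i.e. the new residual; \<open>rL\<close>, \<open>rR\<close>: the old residual at \<open>\<tau>\<close>;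
     \<open>hL\<close>, \<open>hR\<close>: the left-hand sides of the linearised complementarity equations.\<close>
  define pL pR where "pL = part_muL d * part_x d" and "pR = - (part_muR d * part_x d)"
  define rL rR where "rL = part_muL (F Q c A b \<omega> \<tau> z)" and "rR = part_muR (F Q c A b \<omega> \<tau> z)"
  define hL hR where "hL = part_muL z * part_x d + (1 + part_x z) * part_muL d"
    and "hR = - (part_muR z * part_x d) + (1 - part_x z) * part_muR d"
  have box: "- 1 < part_x z $ i" "part_x z $ i < 1" "part_muL z $ i > 0" "part_muR z $ i > 0" for i
    using z by (simp_all add: nbhd_iff)
  have "part_muL (F Q c A b \<omega> (\<sigma> * \<tau>) z + DF Q A \<omega> z *v d) = 0"
    "part_muR (F Q c A b \<omega> (\<sigma> * \<tau>) z + DF Q A \<omega> z *v d) = 0"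
    "part_lam (F Q c A b \<omega> (\<sigma> * \<tau>) z + DF Q A \<omega> z *v d) = part_lam (F Q c A b \<omega> \<tau> z)"
    "part_x (F Q c A b \<omega> (\<sigma> * \<tau>) z + DF Q A \<omega> z *v d) = part_x (F Q c A b \<omega> \<tau> z)"
    unfolding newton using z by (simp_all add: nbhd_iff)
  then have eqs: "hL = (\<sigma> * \<tau>) *\<^sub>R 1 - part_muL z * (1 + part_x z)"
    "hR = (\<sigma> * \<tau>) *\<^sub>R 1 - part_muR z * (1 - part_x z)"
    "A *v part_x d + \<omega> *\<^sub>R part_lam d = 0"
    "Q *v part_x d + \<omega> *\<^sub>R part_x d - part_lam d v* A - part_muL d + part_muR d = 0"
    by (simp_all add: F_parts DF_mult hL_def hR_def eq_neg_iff_add_eq_0 algebra_simps)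
  \<comment> \<open>Monotonicity: the products of increments have a nonnegative sum.\<close>
  have "part_x d \<bullet> (part_lam d v* A) = part_lam d \<bullet> (A *v part_x d)"
    by (simp add: inner_commute[of "part_x d"] dot_lmul_matrix)
  also have "\<dots> = - \<omega> * (part_lam d \<bullet> part_lam d)"
  proof -
    have "A *v part_x d = - \<omega> *\<^sub>R part_lam d" using eqs(3) by (simp add: add_eq_0_iff2)
    then show ?thesis by simp
  qed
  finally have adj: "part_x d \<bullet> (part_lam d v* A) = - \<omega> * (part_lam d \<bullet> part_lam d)" .
  have "part_muL d - part_muR d = Q *v part_x d + \<omega> *\<^sub>R part_x d - part_lam d v* A"
    using eqs(4) by (simp add: algebra_simps)
  then have "part_x d \<bullet> (part_muL d - part_muR d)
      = part_x d \<bullet> (Q *v part_x d) + \<omega> * (part_x d \<bullet> part_x d) + \<omega> * (part_lam d \<bullet> part_lam d)"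
    by (simp only: inner_diff_right[of _ "_ + _"] inner_add_right inner_scaleR_right adj
        mult_minus_left diff_minus_eq_add)
  also have "\<dots> \<ge> 0" using psd \<omega> by (simp add: pos_semidef_def)
  finally have mono: "0 \<le> (\<Sum>i\<in>UNIV. pL $ i) + (\<Sum>i\<in>UNIV. pR $ i)"
    by (simp add: inner_vec_def pL_def pR_def sum_negf sum_subtractf right_diff_distrib mult.commute)
  \<comment> \<open>The old residual and the shift of the target each contribute at most \<open>\<theta> \<tau>\<close> to \<open>\<parallel>(hL, hR)\<parallel>\<close>.\<close>
  have "hL = - rL - ((1 - \<sigma>) * \<tau>) *\<^sub>R 1" "hR = - rR - ((1 - \<sigma>) * \<tau>) *\<^sub>R 1"
    unfolding eqs rL_def rR_def F_parts by (simp_all add: algebra_simps)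
  then have "(hL, hR) = - (rL, rR) - ((1 - \<sigma>) * \<tau>) *\<^sub>R (1, 1)" by simp
  then have "norm (hL, hR) \<le> norm (rL, rR) + norm (((1 - \<sigma>) * \<tau>) *\<^sub>R (1 :: real^'n, 1 :: real^'n))"
    by (metis norm_minus_cancel norm_triangle_ineq4)
  also have "norm (((1 - \<sigma>) * \<tau>) *\<^sub>R (1 :: real^'n, 1 :: real^'n)) = \<tau> * ((1 - \<sigma>) * sqrt (2 * n))"
  proof -
    have "norm (1 :: real^'n, 1 :: real^'n) = sqrt (2 * n)"
      by (simp add: norm_Pair power2_norm_eq_inner inner_vec_def n_def)
    then show ?thesis using \<sigma> \<tau> unfolding norm_scaleR by simp
  qed
  also have "norm (rL, rR) \<le> \<theta> * \<tau>" using z by (simp add: nbhd_iff rL_def rR_def)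
  also have "(1 - \<sigma>) * sqrt (2 * n) \<le> \<theta>"
    using \<sigma>(1) n by (simp add: field_simps)
  finally have h: "norm (hL, hR) \<le> 2 * \<theta> * \<tau>" using \<tau> by (simp add: mult_ac)
  define k where "k = 4 * ((1 - \<theta>) * \<tau>)"
  have k: "k > 0" using \<theta> \<tau> by (simp add: k_def)
  \<comment> \<open>Positive products satisfy \<open>4 (m s) (ds dm) \<le> (m ds + s dm)\<^sup>2\<close>, where \<open>m s \<ge> (1 - \<theta>) \<tau>\<close>.\<close>
  have amgm: "ds * dm \<le> (m * ds + s * dm)\<^sup>2 / k"
    if "\<bar>m * s - \<tau>\<bar> \<le> \<theta> * \<tau>" "0 < s" "0 < m" for s m ds dm
  proof (cases "ds * dm \<le> 0")
    case True
    then show ?thesis using k by (simp add: order.trans)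
  next
    case False
    have "k * (ds * dm) \<le> 4 * (m * s) * (ds * dm)"
      using that False by (intro mult_right_mono) (auto simp: k_def algebra_simps)
    also have "\<dots> = (m * ds + s * dm)\<^sup>2 - (m * ds - s * dm)\<^sup>2"
      by (simp add: power2_eq_square algebra_simps)
    also have "\<dots> \<le> (m * ds + s * dm)\<^sup>2" by simp
    finally show ?thesis using k by (simp add: pos_le_divide_eq mult.commute)
  qed
  have qL: "pL $ i \<le> (hL $ i)\<^sup>2 / k" for i
    using amgm[OF nbhd_complementarity(1)[OF z], of i "part_x d $ i" "part_muL d $ i"] box[of i]
    by (simp add: pL_def hL_def mult.commute)
  have qR: "pR $ i \<le> (hR $ i)\<^sup>2 / k" for i
    using amgm[OF nbhd_complementarity(2)[OF z], of i "- part_x d $ i" "part_muR d $ i"] box[of i]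
    by (simp add: pR_def hR_def mult.commute)
  have nsq: "(norm (u, v))\<^sup>2 = (\<Sum>i\<in>UNIV. (u $ i)\<^sup>2) + (\<Sum>i\<in>UNIV. (v $ i)\<^sup>2)" for u v :: "real^'n"
    unfolding norm_Pair real_sqrt_pow2[OF sum_power2_ge_zero] power2_norm_eq_inner inner_vec_def
    by (simp add: power2_eq_square sum_nonneg)
  have split: "(\<Sum>i\<in>UNIV. f i) = (\<Sum>i\<in>UNIV. f (Inl i)) + (\<Sum>i\<in>UNIV. f (Inr i))" for f :: "'n + 'n \<Rightarrow> real"
    by (simp add: UNIV_Plus_UNIV [symmetric] sum.Plus comp_def del: UNIV_Plus_UNIV)
  have "(norm (pL, pR))\<^sup>2 = (\<Sum>i\<in>UNIV. (case_sum (($) pL) (($) pR) i)\<^sup>2)"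
    by (simp add: nsq split)
  also have "\<dots> \<le> 2 * (\<Sum>i\<in>UNIV. case_sum (\<lambda>i. (hL $ i)\<^sup>2 / k) (\<lambda>i. (hR $ i)\<^sup>2 / k) i)\<^sup>2"
    using mono qL qR k by (intro sum_squares_le_of_sum_nonneg) (auto simp: split split: sum.split)
  also have "\<dots> = 2 * ((norm (hL, hR))\<^sup>2 / k)\<^sup>2"
    by (simp add: nsq split sum_divide_distrib add_divide_distrib)
  also have "\<dots> \<le> 2 * ((2 * \<theta> * \<tau>)\<^sup>2 / k)\<^sup>2"
    using h k by (intro mult_left_mono power_mono divide_right_mono) auto
  also have "(2 * \<theta> * \<tau>)\<^sup>2 / k = \<theta> * \<tau> * (\<theta> / (1 - \<theta>))"
    using \<tau> \<theta> by (simp add: k_def power2_eq_square field_simps)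
  also have "2 * (\<theta> * \<tau> * (\<theta> / (1 - \<theta>)))\<^sup>2 = (\<theta> * \<tau>)\<^sup>2 * (2 * (\<theta> / (1 - \<theta>))\<^sup>2)"
    unfolding power_mult_distrib by (simp only: mult_ac)
  \<comment> \<open>Here the size of \<open>\<theta>\<close> enters: \<open>2 (0.3 / 0.7)\<^sup>2 < 0.7\<^sup>2 \<le> \<sigma>\<^sup>2\<close>.\<close>
  also have "\<dots> \<le> (\<theta> * \<tau>)\<^sup>2 * \<sigma>\<^sup>2"
  proof (intro mult_left_mono)
    have "\<theta> / (1 - \<theta>) \<le> 3 / 7" using \<theta> by (simp add: field_simps)
    then have "(\<theta> / (1 - \<theta>))\<^sup>2 \<le> (3 / 7)\<^sup>2" using \<theta> by (intro power_mono) auto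
    moreover have "(7 / 10)\<^sup>2 \<le> \<sigma>\<^sup>2" using \<sigma>7 by (intro power_mono) auto
    ultimately show "2 * (\<theta> / (1 - \<theta>))\<^sup>2 \<le> \<sigma>\<^sup>2" by (simp add: power2_eq_square)
  qed simp
  finally have "(norm (pL, pR))\<^sup>2 \<le> (\<theta> * (\<sigma> * \<tau>))\<^sup>2" by (simp add: power_mult_distrib mult_ac)
  then have p: "norm (pL, pR) \<le> \<theta> * (\<sigma> * \<tau>)"
    by (rule power2_le_imp_le) (use \<theta> \<tau> \<sigma>7 in simp)
  have t: "0 < \<sigma> * \<tau>" "\<theta> * (\<sigma> * \<tau>) < \<sigma> * \<tau>" using \<sigma>7 \<tau> \<theta> by auto
  have pi: "- (\<sigma> * \<tau>) < pL $ i" "- (\<sigma> * \<tau>) < pR $ i" for i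
    using component_le_norm_cart[of pL i] component_le_norm_cart[of pR i]
      norm_fst_le[of pL pR] norm_snd_le[of pR pL] p t by linarith+
  have posL: "0 < 1 + part_x z $ i + part_x d $ i" "0 < part_muL z $ i + part_muL d $ i" for i
  proof -
    have "hL $ i = \<sigma> * \<tau> - part_muL z $ i * (1 + part_x z $ i)" unfolding eqs by simp
    then show "0 < 1 + part_x z $ i + part_x d $ i" "0 < part_muL z $ i + part_muL d $ i"
      using newton_step_positive[of "1 + part_x z $ i" "part_muL z $ i" "\<sigma> * \<tau>" "part_x d $ i" "part_muL d $ i"]
        box[of i] t pi(1)[of i] by (simp_all add: hL_def pL_def mult.commute)
  qed
  have posR: "0 < 1 - part_x z $ i - part_x d $ i" "0 < part_muR z $ i + part_muR d $ i" for i
  proof -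
    have "hR $ i = \<sigma> * \<tau> - part_muR z $ i * (1 - part_x z $ i)" unfolding eqs by simp
    then show "0 < 1 - part_x z $ i - part_x d $ i" "0 < part_muR z $ i + part_muR d $ i"
      using newton_step_positive[of "1 - part_x z $ i" "part_muR z $ i" "\<sigma> * \<tau>" "- part_x d $ i" "part_muR d $ i"]
        box[of i] t pi(2)[of i] by (simp_all add: hR_def pR_def mult.commute)
  qed
  have "- 1 < part_x z $ i + part_x d $ i" "part_x z $ i + part_x d $ i < 1" for i
    using posL(1)[of i] posR(1)[of i] by linarith+
  then show ?thesis
    unfolding nbhd_iff F' using p posL(2) posR(2) by (simp add: slack_product_def pL_def pR_def)
qed

section \<open>Perturbation of the base point\<close>

lemma mult_matrix_inv: "invertible M \<Longrightarrow> M ** matrix_inv M = mat 1"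
  unfolding invertible_def matrix_inv_def by (metis (mono_tags, lifting) someI_ex)

text \<open>
  With \<open>e = z - zt\<close>, both \<open>z\<close> and \<open>zt\<close> serve as expansion points of \<open>F\<close> at \<open>z + d\<close>. The quadratic terms
  are \<open>slack_product d d\<close> and \<open>slack_product (e + d) (e + d)\<close>, so their difference is of first order
  in \<open>e\<close>; no continuity of the inverse Jacobian is needed.
\<close>

lemma newton_perturbation:
  assumes newton: "F Q c A b \<omega> \<tau> z + DF Q A \<omega> z *v d = 0"
    and inv: "invertible (DF Q A \<omega> zt)"
  shows "norm (DF Q A \<omega> zt *v (zt - matrix_inv (DF Q A \<omega> zt) *v F Q c A b \<omega> \<tau> zt - (z + d)))
    \<le> (2 * norm d + norm (zt - z)) * norm (zt - z)"
proof -
  define M e where "M = DF Q A \<omega> zt" and "e = z - zt"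
  have "F Q c A b \<omega> \<tau> (z + d) = slack_product d d"
    unfolding F_expansion using newton by simp
  moreover have "F Q c A b \<omega> \<tau> (z + d) = F Q c A b \<omega> \<tau> zt + M *v (e + d) + slack_product (e + d) (e + d)"
    using F_expansion[of Q c A b \<omega> \<tau> zt "e + d"] by (simp add: M_def e_def)
  moreover have "slack_product (e + d) (e + d)
      = slack_product e e + slack_product e d + slack_product d e + slack_product d d"
    by (rule parts_eqI) (simp_all add: slack_product_def algebra_simps)
  moreover have "M *v (matrix_inv M *v r) = r" for r
    using inv by (simp add: M_def matrix_vector_mul_assoc mult_matrix_inv)
  ultimately have "M *v (zt - matrix_inv M *v F Q c A b \<omega> \<tau> zt - (z + d))
      = slack_product e e + slack_product e d + slack_product d e"
    by (simp add: e_def algebra_simps)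
  also have "norm \<dots> \<le> norm e * norm e + norm e * norm d + norm d * norm e"
    by (intro order.trans[OF norm_triangle_ineq] add_mono norm_slack_product_le)
  also have "\<dots> = (2 * norm d + norm e) * norm e" by (simp add: algebra_simps)
  finally show ?thesis by (simp add: M_def e_def norm_minus_commute)
qed


section \<open>The inexact step\<close>

theorem theorem4p3:
  fixes Q :: "real^'n^'n" and c :: "real^'n" and A :: "real^'n^'m" and b :: "real^'m"
    and n tol :: real
    and \<theta> \<beta> \<sigma> C\<^sub>q \<omega> C_lam C_\<Delta>\<mu> \<tau>\<^sub>A \<tau>\<^sub>E C\<^sub>\<mu> C\<^sub>z c_gap C_DF C_DFinv \<kappa>_DF :: real
    and C_\<delta>F C_\<delta>DF C_\<delta>\<Delta>z C\<^sub>\<nu> \<nu>\<^sub>2 \<nu>\<^sub>1 \<nu>\<^sub>0 C_solver :: real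
  defines "n \<equiv> real CARD('n)"
  assumes Q_sym: "transpose Q = Q" and Q_psd: "pos_semidef Q"
    and tol: "tol > 0"
    and pos: "\<theta> > 0" "\<beta> > 0" "\<sigma> > 0" "C\<^sub>q > 0" "\<omega> > 0" "C_lam > 0" "C_\<Delta>\<mu> > 0" "\<tau>\<^sub>A > 0" "\<tau>\<^sub>E > 0"
      "C\<^sub>\<mu> > 0" "C\<^sub>z > 0" "c_gap > 0" "C_DF > 0" "C_DFinv > 0" "\<kappa>_DF > 0"
      "C_\<delta>F > 0" "C_\<delta>DF > 0" "C_\<delta>\<Delta>z > 0" "C\<^sub>\<nu> > 0" "\<nu>\<^sub>2 > 0" "\<nu>\<^sub>1 > 0" "\<nu>\<^sub>0 > 0"
    and theta: "\<theta> \<le> 0.3"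
    and beta: "\<beta> \<le> \<theta>"
    and sigma: "1 - \<beta> / sqrt (2 * n) \<le> \<sigma>" "\<sigma> < 1"
    and C\<^sub>q: "C\<^sub>q \<ge> spectral_norm Q * n + norm c * sqrt n"
    and omega: "\<omega> \<le> min (tol / (2 * n)) (min (tol\<^sup>2 / (16 * (4 * C\<^sub>q + n))) 1)"
    and C_lam: "C_lam \<ge> (spectral_norm A * sqrt n + norm b) / \<omega>"
    and C_\<Delta>\<mu>: "C_\<Delta>\<mu> \<ge> (\<omega> + spectral_norm Q) * sqrt n + norm c + spectral_norm A * C_lam"
    and \<tau>\<^sub>A: "\<tau>\<^sub>A \<ge> max (1/4 * spectral_norm (Q + mat \<omega> + (1 / \<omega>) *\<^sub>R (transpose A ** A)))
                     (4 * norm (c - (1 / \<omega>) *\<^sub>R (transpose A *v b)))"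
    and \<tau>\<^sub>E: "\<tau>\<^sub>E \<le> tol\<^sup>2 * \<omega> / (48 * n * max (spectral_norm A) C\<^sub>q)"
    and C\<^sub>\<mu>: "C\<^sub>\<mu> \<ge> sqrt (2 * n) * (C_\<Delta>\<mu> + (1 + \<theta>) * \<tau>\<^sub>A)"
    and C\<^sub>z: "C\<^sub>z \<ge> sqrt (n + C_lam\<^sup>2 + C\<^sub>\<mu>\<^sup>2) + 0.1"
    and c_gap: "c_gap \<le> (1 - \<theta>) / (1 + C\<^sub>z) * (\<sigma> * \<tau>\<^sub>E / 2)"
    and C_DF: "C_DF \<ge> spectral_norm Q + 2 * \<omega> + 2 * norm A + 4 + 4 * C\<^sub>z"
    and C_DFinv: "C_DFinv \<ge> 1 / c_gap * max (1 / \<omega>) (C\<^sub>z / c_gap)"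
    and \<kappa>_DF: "\<kappa>_DF \<ge> C_DF * C_DFinv"
    and C_\<delta>F: "C_\<delta>F \<ge> C_DF"
    and C_\<delta>DF: "C_\<delta>DF \<ge> 2"
    and C_\<delta>\<Delta>z: "C_\<delta>\<Delta>z \<ge> 2 * \<kappa>_DF"
    and C\<^sub>\<nu>: "C\<^sub>\<nu> \<ge> max (2 * C_\<delta>\<Delta>z * (C_\<delta>F * C_DFinv + 2 / \<omega> * C_\<delta>DF * C\<^sub>z))
                     (1 + C_DFinv * C_\<delta>F)"
    and \<nu>\<^sub>2: "\<nu>\<^sub>2 \<le> min (min 0.1 (c_gap / C\<^sub>\<nu>))
                     (min (\<omega> / (2 * C_\<delta>DF * \<kappa>_DF)) (\<theta> * \<sigma> * \<tau>\<^sub>E / (2 * C\<^sub>\<nu> * C_\<delta>F)))"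
    and \<nu>\<^sub>1: "\<nu>\<^sub>1 \<le> \<nu>\<^sub>2 / C\<^sub>\<nu>"
    and \<nu>\<^sub>0: "\<nu>\<^sub>0 \<le> min (\<nu>\<^sub>1 / C\<^sub>\<nu>) (tol / (2 * max (spectral_norm A) C\<^sub>q))"
  shows "\<exists>\<epsilon>\<^sub>0 > 0. \<forall>\<epsilon>_mach. 0 < \<epsilon>_mach \<and> \<epsilon>_mach \<le> \<epsilon>\<^sub>0 \<longrightarrow>
           (\<forall>\<tau> zt. \<tau>\<^sub>E \<le> \<tau> \<and> \<tau> \<le> \<tau>\<^sub>A \<and> zt \<in> nbhd_pert Q c A b \<omega> \<theta> \<tau> \<nu>\<^sub>0 \<longrightarrow>
              invertible (DF Q A \<omega> zt) \<and>
              (\<forall>zhat. computed_step C_solver C\<^sub>z \<kappa>_DF \<epsilon>_mach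
                         (DF Q A \<omega> zt) (F Q c A b \<omega> (\<sigma> * \<tau>) zt) zt zhat
                 \<longrightarrow> zhat \<in> nbhd_pert Q c A b \<omega> \<theta> (\<sigma> * \<tau>) \<nu>\<^sub>1))"
proof -
  have n: "1 \<le> n" unfolding n_def by (simp add: Suc_leI)
  have sqrt2n: "0 < sqrt (2 * n)" using n by simp
  have \<sigma>': "1 - \<theta> / sqrt (2 * n) \<le> \<sigma>"
    using sigma(1) divide_right_mono[OF beta, of "sqrt (2 * n)"] sqrt2n by linarith
  have \<theta>: "0 < \<theta>" "\<theta> \<le> 0.3" "\<theta> < 1" "0 \<le> \<theta>" using pos(1) theta by auto
  have "1 \<le> sqrt (n + C_lam\<^sup>2 + C\<^sub>\<mu>\<^sup>2)" using n by (simp add: add_increasing2)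
  then have Cz1: "1 \<le> C\<^sub>z" using C\<^sub>z by linarith
  have norm_nbhd: "norm z \<le> C\<^sub>z - 0.1" if "z \<in> nbhd Q c A b \<omega> \<theta> \<tau>" "\<tau> \<le> \<tau>\<^sub>A" for z \<tau>
    using nbhd_norm_le[OF that(1) pos(5) \<theta>(4) that(2) C_lam[unfolded n_def] C_\<Delta>\<mu>[unfolded n_def] C\<^sub>\<mu>[unfolded n_def]] C\<^sub>z
    unfolding n_def by linarith
  have half: "2 * (u * (v / 2)) = u * v" for u v :: real by simp
  \<comment> \<open>At exact neighbourhood points the gap is \<open>2 c_gap\<close>; moving by \<open>\<nu>\<^sub>0 \<le> c_gap\<close> leaves \<open>c_gap\<close>.\<close>
  have gap: "2 * c_gap \<le> 1 + part_x z $ i \<and> 2 * c_gap \<le> 1 - part_x z $ i \<and>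
      2 * c_gap \<le> part_muL z $ i \<and> 2 * c_gap \<le> part_muR z $ i"
    if z: "z \<in> nbhd Q c A b \<omega> \<theta> \<tau>" and \<tau>: "\<tau>\<^sub>E \<le> \<tau>" "\<tau> \<le> \<tau>\<^sub>A" for z \<tau> i
  proof -
    have "norm z \<le> C\<^sub>z" using norm_nbhd[OF z \<tau>(2)] by simp
    have "2 * c_gap \<le> 2 * ((1 - \<theta>) / (1 + C\<^sub>z) * (\<sigma> * \<tau>\<^sub>E / 2))"
      using c_gap by (rule mult_left_mono) simp
    also have "\<dots> = (1 - \<theta>) / (1 + C\<^sub>z) * (\<sigma> * \<tau>\<^sub>E)" by (rule half)
    also have "\<dots> \<le> (1 - \<theta>) / (1 + C\<^sub>z) * \<tau>"
    proof (rule mult_left_mono)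
      have "\<sigma> * \<tau>\<^sub>E \<le> 1 * \<tau>" using pos sigma(2) \<tau> by (intro mult_mono) auto
      then show "\<sigma> * \<tau>\<^sub>E \<le> \<tau>" by simp
      show "0 \<le> (1 - \<theta>) / (1 + C\<^sub>z)" using \<theta> Cz1 by simp
    qed
    finally have g: "2 * c_gap \<le> (1 - \<theta>) / (1 + C\<^sub>z) * \<tau>" .
    have "0 < \<tau>" using pos(9) \<tau> by linarith
    then show ?thesis using nbhd_gap[OF z \<open>norm z \<le> C\<^sub>z\<close> Cz1 \<theta>(3) _ g] by blast
  qed
  have Cnu: "1 + C_DFinv * C_\<delta>F \<le> C\<^sub>\<nu>" using C\<^sub>\<nu> by simp
  then have Cnu1: "1 \<le> C\<^sub>\<nu>" using mult_pos_pos[OF pos(14) pos(16)] by linarith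
  have \<nu>: "\<nu>\<^sub>0 * C\<^sub>\<nu> \<le> \<nu>\<^sub>1" "\<nu>\<^sub>1 * C\<^sub>\<nu> \<le> \<nu>\<^sub>2" "\<nu>\<^sub>2 * C\<^sub>\<nu> \<le> c_gap" "\<nu>\<^sub>2 \<le> 0.1"
    using \<nu>\<^sub>0 \<nu>\<^sub>1 \<nu>\<^sub>2 pos(19) by (simp_all add: pos_le_divide_eq)
  have shrink: "v \<le> w" if "v * C\<^sub>\<nu> \<le> w" "0 < v" for v w
    using mult_left_mono[OF Cnu1 less_imp_le[OF that(2)]] that(1) by linarith
  have small: "\<nu>\<^sub>0 \<le> 0.1" "\<nu>\<^sub>0 \<le> c_gap"
    using shrink[OF \<nu>(1) pos(22)] shrink[OF \<nu>(2) pos(21)] shrink[OF \<nu>(3) pos(20)] \<nu>(4) by linarith+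
  have DF_inv: "norm d \<le> C_DFinv * norm (DF Q A \<omega> zt *v d)"
    if z: "z \<in> nbhd Q c A b \<omega> \<theta> \<tau>" and \<tau>: "\<tau>\<^sub>E \<le> \<tau>" "\<tau> \<le> \<tau>\<^sub>A" and zt: "norm (zt - z) \<le> \<nu>\<^sub>0"
    for z zt \<tau> d
  proof -
    have close: "\<bar>part_x zt $ i - part_x z $ i\<bar> \<le> c_gap" "\<bar>part_muL zt $ i - part_muL z $ i\<bar> \<le> c_gap"
      "\<bar>part_muR zt $ i - part_muR z $ i\<bar> \<le> c_gap" for i
      using abs_part_le_norm[of "zt - z" i] zt small by simp_all
    have "norm zt \<le> C\<^sub>z"
      using norm_triangle_sub[of zt z] norm_nbhd[OF z \<tau>(2)] zt small(1) by linarith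
    then have upper: "part_muL zt $ i \<le> C\<^sub>z" "part_muR zt $ i \<le> C\<^sub>z" for i
      using abs_part_le_norm(2,3)[of zt i] by linarith+
    have lower: "c_gap \<le> 1 + part_x zt $ i" "c_gap \<le> 1 - part_x zt $ i"
      "c_gap \<le> part_muL zt $ i" "c_gap \<le> part_muR zt $ i" for i
      using gap[OF z \<tau>, of i] close[of i] by (simp_all add: abs_le_iff)
    have "c_gap \<le> 1" using lower(1,2)[of undefined] by linarith
    then have "norm d \<le> 1 / c_gap * max (1 / \<omega>) (C\<^sub>z / c_gap) * norm (DF Q A \<omega> zt *v d)"
      using lower upper by (intro DF_lower_bound Q_psd pos)
    also have "\<dots> \<le> C_DFinv * norm (DF Q A \<omega> zt *v d)"
      by (intro mult_right_mono C_DFinv) simp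
    finally show ?thesis .
  qed
  have "4 + 4 * C\<^sub>z \<le> C_\<delta>F"
    using C_\<delta>F C_DF spectral_norm_nonneg[of Q] pos(5) norm_ge_zero[of A] by linarith
  then have "C_DFinv * (1 + 4 * C\<^sub>z) \<le> C_DFinv * C_\<delta>F"
    using pos(14) by (intro mult_left_mono) auto
  then have Lip: "C_DFinv * (1 + 4 * C\<^sub>z) \<le> C\<^sub>\<nu> - 1" using Cnu by linarith
  \<comment> \<open>The summand 1 keeps the denominator positive for \<open>C_solver = 0\<close>; negative values are harmless.\<close>
  define \<epsilon>\<^sub>0 where "\<epsilon>\<^sub>0 = \<nu>\<^sub>0 / (\<bar>C_solver\<bar> * C\<^sub>z * \<kappa>_DF + 1)"
  have den: "0 < \<bar>C_solver\<bar> * C\<^sub>z * \<kappa>_DF + 1" using pos by (intro add_nonneg_pos mult_nonneg_nonneg) auto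
  have \<epsilon>0: "0 < \<epsilon>\<^sub>0" unfolding \<epsilon>\<^sub>0_def using den pos(22) by simp
  have rounding: "C_solver * C\<^sub>z * \<kappa>_DF * \<epsilon> \<le> \<nu>\<^sub>0" if "0 < \<epsilon>" "\<epsilon> \<le> \<epsilon>\<^sub>0" for \<epsilon>
  proof -
    have "C_solver * C\<^sub>z * \<kappa>_DF * \<epsilon> \<le> (\<bar>C_solver\<bar> * C\<^sub>z * \<kappa>_DF + 1) * \<epsilon>"
    proof (rule mult_right_mono)
      have "C_solver * C\<^sub>z * \<kappa>_DF \<le> \<bar>C_solver\<bar> * C\<^sub>z * \<kappa>_DF" using pos by (intro mult_right_mono) auto
      then show "C_solver * C\<^sub>z * \<kappa>_DF \<le> \<bar>C_solver\<bar> * C\<^sub>z * \<kappa>_DF + 1" by linarith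
    qed (use that in simp)
    also have "\<dots> \<le> (\<bar>C_solver\<bar> * C\<^sub>z * \<kappa>_DF + 1) * \<epsilon>\<^sub>0" using that den by (intro mult_left_mono) auto
    also have "\<dots> = \<nu>\<^sub>0" unfolding \<epsilon>\<^sub>0_def using den by simp
    finally show ?thesis .
  qed
  have inv: "invertible (DF Q A \<omega> zt)"
    if "z \<in> nbhd Q c A b \<omega> \<theta> \<tau>" "\<tau>\<^sub>E \<le> \<tau>" "\<tau> \<le> \<tau>\<^sub>A" "norm (zt - z) \<le> \<nu>\<^sub>0" for z zt \<tau>
    using DF_inv[OF that] by (rule invertible_if_bounded_below)
  have step: "zhat \<in> nbhd_pert Q c A b \<omega> \<theta> (\<sigma> * \<tau>) \<nu>\<^sub>1"
    if \<epsilon>: "0 < \<epsilon>" "\<epsilon> \<le> \<epsilon>\<^sub>0" and \<tau>: "\<tau>\<^sub>E \<le> \<tau>" "\<tau> \<le> \<tau>\<^sub>A"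
      and z: "z \<in> nbhd Q c A b \<omega> \<theta> \<tau>" and zt: "norm (zt - z) \<le> \<nu>\<^sub>0"
      and comp: "computed_step C_solver C\<^sub>z \<kappa>_DF \<epsilon> (DF Q A \<omega> zt) (F Q c A b \<omega> (\<sigma> * \<tau>) zt) zt zhat"
    for \<epsilon> \<tau> z zt zhat
  proof -
    have \<tau>0: "0 < \<tau>" using pos(9) \<tau> by linarith
    define d where "d = - (matrix_inv (DF Q A \<omega> z) *v F Q c A b \<omega> (\<sigma> * \<tau>) z)"
    have "invertible (DF Q A \<omega> z)" using inv[OF z \<tau>, of z] pos(22) by simp
    then have newton: "F Q c A b \<omega> (\<sigma> * \<tau>) z + DF Q A \<omega> z *v d = 0"
      by (simp add: d_def linear_neg[OF matrix_vector_mul_linear] matrix_vector_mul_assoc mult_matrix_inv)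
    have zd: "z + d \<in> nbhd Q c A b \<omega> \<theta> (\<sigma> * \<tau>)"
      by (rule newton_step_in_nbhd[OF Q_psd pos(5) \<theta>(1,2) \<tau>0 \<sigma>'[unfolded n_def] sigma(2) z newton])
    have "\<sigma> * \<tau> \<le> 1 * \<tau>" using sigma(2) \<tau>0 by (intro mult_right_mono) auto
    then have "norm (z + d) \<le> C\<^sub>z" "norm z \<le> C\<^sub>z"
      using norm_nbhd[OF zd] norm_nbhd[OF z] \<tau> by simp_all
    then have d: "norm d \<le> 2 * C\<^sub>z" using norm_triangle_ineq4[of "z + d" z] by simp
    obtain e where e: "norm e \<le> C_solver * C\<^sub>z * \<kappa>_DF * \<epsilon>"
      and zhat: "zhat = zt - matrix_inv (DF Q A \<omega> zt) *v F Q c A b \<omega> (\<sigma> * \<tau>) zt + e"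
      using comp by (auto simp: computed_step_def)
    define w where "w = zt - matrix_inv (DF Q A \<omega> zt) *v F Q c A b \<omega> (\<sigma> * \<tau>) zt - (z + d)"
    have "norm w \<le> C_DFinv * norm (DF Q A \<omega> zt *v w)" by (rule DF_inv[OF z \<tau> zt])
    also have "\<dots> \<le> C_DFinv * ((2 * norm d + norm (zt - z)) * norm (zt - z))"
      unfolding w_def using pos(14)
      by (intro mult_left_mono newton_perturbation newton inv[OF z \<tau> zt]) simp
    also have "\<dots> \<le> C_DFinv * ((1 + 4 * C\<^sub>z) * \<nu>\<^sub>0)"
      using pos(14) d zt small(1) Cz1 by (intro mult_left_mono mult_mono) auto
    also have "\<dots> \<le> (C\<^sub>\<nu> - 1) * \<nu>\<^sub>0"
      using mult_right_mono[OF Lip, of \<nu>\<^sub>0] pos(22) by (simp add: mult.assoc)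
    finally have "norm w \<le> \<nu>\<^sub>0 * C\<^sub>\<nu> - \<nu>\<^sub>0" by (simp add: algebra_simps)
    moreover have "norm e \<le> \<nu>\<^sub>0" using e rounding[OF \<epsilon>] by linarith
    moreover have "zhat - (z + d) = w + e" by (simp add: zhat w_def)
    ultimately have "norm (zhat - (z + d)) \<le> \<nu>\<^sub>1"
      using norm_triangle_ineq[of w e] \<nu>(1) by simp
    with zd show ?thesis unfolding nbhd_pert_def by blast
  qed
  show ?thesis
  proof (intro exI[of _ \<epsilon>\<^sub>0] conjI \<epsilon>0 allI impI)
    fix \<epsilon>_mach \<tau> and zt :: "real^('n, 'm) idx"
    assume "0 < \<epsilon>_mach \<and> \<epsilon>_mach \<le> \<epsilon>\<^sub>0"
      and "\<tau>\<^sub>E \<le> \<tau> \<and> \<tau> \<le> \<tau>\<^sub>A \<and> zt \<in> nbhd_pert Q c A b \<omega> \<theta> \<tau> \<nu>\<^sub>0"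
    then obtain z where z: "0 < \<epsilon>_mach" "\<epsilon>_mach \<le> \<epsilon>\<^sub>0" "\<tau>\<^sub>E \<le> \<tau>" "\<tau> \<le> \<tau>\<^sub>A"
      "z \<in> nbhd Q c A b \<omega> \<theta> \<tau>" "norm (zt - z) \<le> \<nu>\<^sub>0"
      unfolding nbhd_pert_def by blast
    show "invertible (DF Q A \<omega> zt)" by (rule inv[OF z(5,3,4,6)])
    fix zhat
    assume "computed_step C_solver C\<^sub>z \<kappa>_DF \<epsilon>_mach (DF Q A \<omega> zt) (F Q c A b \<omega> (\<sigma> * \<tau>) zt) zt zhat"
    then show "zhat \<in> nbhd_pert Q c A b \<omega> \<theta> (\<sigma> * \<tau>) \<nu>\<^sub>1" by (rule step[OF z])
  qed
qed

end
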